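(* Let $P\in\mathbb{C}\{x,y\}$ with $P(0,y)\not\equiv0$, having no zeros in $U\cap(\mathbb{R}\times\mathbb{H})$ for a neighborhood $U$ of the origin and no factors in common with $\bar P$, and write $P=u\prod_{j=1}^M(y+q_j(x)+x^{2L_j}\psi_j(x^{1/k}))$ as in the context. Let $K=\max\{2L_1,\dots,2L_M\}$. If $Q\in\mathbb{C}\{x,y\}$ and $Q/P\in L^{\infty}_{loc}$, then $$\frac{\partial}{\partial y}\frac{Q}{P}\in L^{\mathfrak{p}}_{loc}\quad\text{for all }1\le\mathfrak{p}<1+1/K.$$
   Context: $\mathbb{H}=\{\operatorname{Im}z>0\}$, $\bar P(x,y)=\overline{P(\bar x,\bar y)}$. Such $P$ factors locally as $P=u\prod_{j=1}^M(y+q_j(x)+x^{2L_j}\psi_j(x^{1/k}))$, $M=\mathrm{Ord}(P(0,y))$, with $u$ a unit in $\mathbb{C}\{x,y\}$, $k\ge1$, $L_j\in\mathbb{N}$, $q_j\in\mathbb{R}[x]$, $q_j(0)=0$, $\deg q_j<2L_j$, $\psi_j\in\mathbb{C}\{x\}$, $\operatorname{Im}\psi_j(0)>0$. $f\in L^{\mathfrak{p}}_{loc}$ means $f\in L^{\mathfrak{p}}(U')$ (Lebesgue measure) for some neighborhood $U'$ of $(0,0)$ in $\mathbb{R}^2$, $1\le\mathfrak{p}\le\infty$. *)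

theory Defs
  imports "HOL-Complex_Analysis.Complex_Analysis" "HOL-Computational_Algebra.Polynomial"
begin

text \<open>Convergent power series in two variables: a function on a neighbourhood of the
origin of C^2 given there by an (unconditionally, hence absolutely) convergent double power series.
Elements of C{x,y} are represented by such functions (only their germ at 0 matters).\<close>
definition conv2 :: "(complex \<Rightarrow> complex \<Rightarrow> complex) \<Rightarrow> bool" where
  "conv2 F \<longleftrightarrow> (\<exists>r>0. \<exists>a :: nat \<times> nat \<Rightarrow> complex. \<forall>x y. cmod x < r \<longrightarrow> cmod y < r \<longrightarrow>
      ((\<lambda>(i,j). a (i,j) * x ^ i * y ^ j) has_sum F x y) UNIV)"

definition conv1 :: "(complex \<Rightarrow> complex) \<Rightarrow> bool" where
  "conv1 f \<longleftrightarrow> (\<exists>r>0. \<exists>a :: nat \<Rightarrow> complex. \<forall>x. cmod x < r \<longrightarrow>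
      ((\<lambda>i. a i * x ^ i) has_sum f x) UNIV)"

definition conj2 :: "(complex \<Rightarrow> complex \<Rightarrow> complex) \<Rightarrow> complex \<Rightarrow> complex \<Rightarrow> complex" where
  "conj2 P x y = cnj (P (cnj x) (cnj y))"

definition divides2 :: "(complex \<Rightarrow> complex \<Rightarrow> complex) \<Rightarrow> (complex \<Rightarrow> complex \<Rightarrow> complex) \<Rightarrow> bool" where
  "divides2 D F \<longleftrightarrow> (\<exists>A. conv2 A \<and> (\<forall>\<^sub>F z in nhds (0,0). F (fst z) (snd z) = D (fst z) (snd z) * A (fst z) (snd z)))"

text \<open>P and Pbar have no common factor: every common divisor in C{x,y} is a unit
(a non-unit of C{x,y} is exactly an element vanishing at the origin).\<close>
definition no_common_factor :: "(complex \<Rightarrow> complex \<Rightarrow> complex) \<Rightarrow> (complex \<Rightarrow> complex \<Rightarrow> complex) \<Rightarrow> bool" where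
  "no_common_factor F G \<longleftrightarrow> \<not> (\<exists>D. conv2 D \<and> D 0 0 = 0 \<and> divides2 D F \<and> divides2 D G)"

definition restrR2 :: "(complex \<Rightarrow> complex \<Rightarrow> complex) \<Rightarrow> real \<times> real \<Rightarrow> complex" where
  "restrR2 F z = F (complex_of_real (fst z)) (complex_of_real (snd z))"

definition dy :: "(real \<times> real \<Rightarrow> complex) \<Rightarrow> real \<times> real \<Rightarrow> complex" where
  "dy f z = vector_derivative (\<lambda>t. f (fst z, t)) (at (snd z))"

definition Lp_loc :: "real \<Rightarrow> (real \<times> real \<Rightarrow> complex) \<Rightarrow> bool" where
  "Lp_loc p f \<longleftrightarrow> (\<exists>U. open U \<and> (0,0) \<in> U \<and> f \<in> borel_measurable (lebesgue_on U) \<and>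
      integrable (lebesgue_on U) (\<lambda>z. norm (f z) powr p))"

definition Linf_loc :: "(real \<times> real \<Rightarrow> complex) \<Rightarrow> bool" where
  "Linf_loc f \<longleftrightarrow> (\<exists>U. open U \<and> (0,0) \<in> U \<and> f \<in> borel_measurable (lebesgue_on U) \<and>
      (\<exists>C. AE z in lebesgue_on U. norm (f z) \<le> C))"

end

theory Submission
  imports Defs
begin

text \<open>
  For fixed small real \<open>x \<noteq> 0\<close> the zeros \<open>a\<^sub>j\<close> of \<open>P(x, \<cdot>)\<close> lie in the lower half-plane. On the real
  line \<open>|y - a\<^sub>j| = |y - cnj a\<^sub>j|\<close>, so boundedness of \<open>Q/P\<close> there and the maximum principle on the
  two half-discs give \<open>|Q| \<le> C \<Prod>|y - a\<^sub>j|\<close> above and \<open>|Q| \<le> C \<Prod>|y - cnj a\<^sub>j|\<close> below the real axis.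
  Around a real point \<open>y\<close>, on the disc whose radius \<open>d\<close> is half the distance to the nearest zero, both
  products are comparable to \<open>\<Prod>|y - a\<^sub>j|\<close>, so \<open>Q/P\<close> stays bounded there and Cauchy's
  inequality bounds its \<open>y\<close>-derivative by \<open>C/d\<close>. Finally \<open>|y - a\<^sub>j|\<close> dominates both
  \<open>|y + q\<^sub>j(x)|\<close> and \<open>|x|\<close> to the power \<open>2L\<^sub>j\<close>, which makes the \<open>p\<close>-th power of \<open>1/d\<close> integrable.
\<close>

subsection \<open>Functions bounded by products over zeros in a half-plane\<close>

lemma half_disc_bound:
  fixes f A :: "complex \<Rightarrow> complex" and s :: real
  assumes s: "s \<noteq> 0" and f: "f holomorphic_on ball 0 R" and A: "A holomorphic_on ball 0 R" and r: "0 < r" "r < R"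
    and nz: "\<And>y. norm y \<le> r \<Longrightarrow> s * Im y \<ge> 0 \<Longrightarrow> A y \<noteq> 0"
    and real_bd: "\<And>y. norm y \<le> r \<Longrightarrow> Im y = 0 \<Longrightarrow> norm (f y) \<le> C * norm (A y)"
    and arc_bd: "\<And>y. norm y = r \<Longrightarrow> s * Im y \<ge> 0 \<Longrightarrow> norm (f y) \<le> C * norm (A y)"
    and y: "norm y \<le> r" "s * Im y \<ge> 0"
  shows "norm (f y) \<le> C * norm (A y)"
proof -
  define S where "S = cball 0 r \<inter> {y. s * Im y \<ge> 0}"
  have clS: "closed S" unfolding S_def
    by (intro closed_Int closed_cball closed_Collect_le continuous_intros)
  have SR: "S \<subseteq> ball 0 R" using r by (auto simp: S_def)
  have hol: "(\<lambda>y. f y / A y) holomorphic_on S"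
    using SR nz by (intro holomorphic_intros holomorphic_on_subset[OF f] holomorphic_on_subset[OF A]) (auto simp: S_def)
  have bdd: "norm (f w / A w) \<le> C" if "w \<in> frontier S" for w
  proof -
    have wS: "w \<in> S" using that clS by (simp add: frontier_def)
    have "ball 0 r \<inter> {y. s * Im y > 0} \<subseteq> interior S"
      by (rule interior_maximal) (auto simp: S_def intro!: open_Collect_less continuous_intros)
    moreover have "w \<notin> interior S" using that by (simp add: frontier_def)
    ultimately have "w \<notin> ball 0 r \<inter> {y. s * Im y > 0}" by blast
    with wS have "norm w = r \<or> Im w = 0" using s by (auto simp: S_def)
    with wS real_bd[of w] arc_bd[of w] have "norm (f w) \<le> C * norm (A w)" by (auto simp: S_def)
    with nz[of w] wS show ?thesis by (simp add: S_def norm_divide divide_le_eq)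
  qed
  have "norm (f y / A y) \<le> C"
  proof (rule maximum_modulus_frontier[of "\<lambda>y. f y / A y" S])
    show "(\<lambda>y. f y / A y) holomorphic_on interior S"
      using hol interior_subset by (rule holomorphic_on_subset)
    show "continuous_on (closure S) (\<lambda>y. f y / A y)"
      using hol clS by (simp add: holomorphic_on_imp_continuous_on)
    show "bounded S" by (simp add: S_def bounded_Int)
    show "y \<in> S" using y by (simp add: S_def)
  qed (use bdd in auto)
  with nz[OF y] show ?thesis by (simp add: norm_divide divide_le_eq)
qed

lemma prod_roots_lower_bound:
  fixes a :: "nat \<Rightarrow> complex"
  assumes "\<And>j. j < M \<Longrightarrow> norm (a j) \<le> r / 2" "norm y = r"
  shows "(r / 2) ^ M \<le> norm (\<Prod>j<M. y - a j)"
proof -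
  have "r \<ge> 0" using assms(2) norm_ge_zero[of y] by simp
  have "(\<Prod>j<M. r / 2) \<le> (\<Prod>j<M. norm (y - a j))"
  proof (rule prod_mono, intro conjI)
    fix j assume "j \<in> {..<M}"
    then show "r / 2 \<le> norm (y - a j)"
      using assms norm_triangle_ineq2[of y "a j"] by fastforce
  qed (use \<open>r \<ge> 0\<close> in auto)
  then show ?thesis by (simp add: prod_norm)
qed

lemma bound_near_real_point:
  fixes f :: "complex \<Rightarrow> complex" and a :: "nat \<Rightarrow> complex" and y0 :: real
  assumes f: "f holomorphic_on ball 0 R" and r: "0 < r" "r < R"
    and Im_a: "\<And>j. j < M \<Longrightarrow> Im (a j) < 0"
    and norm_a: "\<And>j. j < M \<Longrightarrow> norm (a j) \<le> r / 2"
    and real_bd: "\<And>y::real. \<bar>y\<bar> \<le> r \<Longrightarrow> norm (f (of_real y)) \<le> C * norm (\<Prod>j<M. of_real y - a j)"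
    and D: "\<And>y. norm y = r \<Longrightarrow> norm (f y) \<le> D" "D \<le> C * (r / 2) ^ M"
    and C: "C \<ge> 0"
    and y0: "\<bar>y0\<bar> \<le> r / 2" and d: "d \<le> r / 2" "\<And>j. j < M \<Longrightarrow> d \<le> norm (of_real y0 - a j) / 2"
    and y: "norm (y - of_real y0) \<le> d"
  shows "norm (f y) \<le> C * 3 ^ M * norm (\<Prod>j<M. y - a j)"
proof -
  have arc: "norm (f w) \<le> C * norm (\<Prod>j<M. w - b j)"
    if "norm w = r" "\<And>j. j < M \<Longrightarrow> norm (b j) \<le> r / 2" for w b
    using D(1)[OF that(1)] D(2) mult_left_mono[OF prod_roots_lower_bound[of M b r w] C] that by force
  have nr: "norm y \<le> r"
    using y y0 d(1) norm_triangle_ineq[of "y - of_real y0" "of_real y0"] by simp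
  have half: "norm (f y) \<le> C * norm (\<Prod>j<M. y - b j)"
    if s: "s \<noteq> 0" "s * Im y \<ge> 0" and b: "\<And>j. j < M \<Longrightarrow> s * Im (b j) < 0"
      "\<And>j. j < M \<Longrightarrow> b j = a j \<or> b j = cnj (a j)" for s b
  proof (rule half_disc_bound[OF s(1) f _ r _ _ _ nr s(2)])
    have nb: "norm (b j) \<le> r / 2" if "j < M" for j
      using b(2)[OF that] norm_a[OF that] by auto
    show "(\<lambda>y. \<Prod>j<M. y - b j) holomorphic_on ball 0 R" by (intro holomorphic_intros)
    show "(\<Prod>j<M. w - b j) \<noteq> 0" if "s * Im w \<ge> 0" for w
      using that b(1) by (auto simp: prod_zero_iff) (metis not_less)
    show "norm (f w) \<le> C * norm (\<Prod>j<M. w - b j)" if "norm w \<le> r" "Im w = 0" for w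
    proof -
      define t where "t = Re w"
      have t: "w = of_real t" using that by (simp add: t_def complex_eq_iff)
      have "norm (of_real t - b j) = norm (of_real t - a j)" if "j < M" for j
        using b(2)[OF that] by (metis complex_cnj_diff complex_cnj_complex_of_real complex_mod_cnj)
      then show ?thesis using real_bd[of t] that t by (simp add: prod_norm[symmetric])
    qed
    show "norm (f w) \<le> C * norm (\<Prod>j<M. w - b j)" if "norm w = r" for w
      using arc that nb by blast
  qed
  obtain b where b: "\<And>j. j < M \<Longrightarrow> b j = a j \<or> b j = cnj (a j)"
    and fb: "norm (f y) \<le> C * norm (\<Prod>j<M. y - b j)"
  proof (cases "Im y \<ge> 0")
    case True
    with half[of 1 a] Im_a that[of a] show ?thesis by simp
  next
    case False
    with half[of "-1" "\<lambda>j. cnj (a j)"] Im_a that[of "\<lambda>j. cnj (a j)"] show ?thesis by simp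
  qed
  have "(\<Prod>j<M. norm (y - b j)) \<le> (\<Prod>j<M. 3 * norm (y - a j))"
  proof (rule prod_mono, intro conjI)
    fix j assume j: "j \<in> {..<M}"
    have "cnj (of_real y0 - a j) = of_real y0 - cnj (a j)" by simp
    then have eq: "norm (of_real y0 - b j) = norm (of_real y0 - a j)"
      using b[of j] j by (metis complex_mod_cnj lessThan_iff)
    have "norm (y - b j) \<le> norm (y - of_real y0) + norm (of_real y0 - b j)"
      using norm_triangle_ineq[of "y - of_real y0" "of_real y0 - b j"] by simp
    moreover have "norm (of_real y0 - a j) \<le> norm (y - of_real y0) + norm (y - a j)"
      using norm_triangle_ineq4[of "y - a j" "y - of_real y0"] by simp
    ultimately show "norm (y - b j) \<le> 3 * norm (y - a j)"
      using eq d(2)[of j] j y by auto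
  qed auto
  then have "norm (\<Prod>j<M. y - b j) \<le> 3 ^ M * norm (\<Prod>j<M. y - a j)"
    by (simp add: prod_norm prod.distrib)
  from mult_left_mono[OF this C] fb show ?thesis by (simp add: mult.assoc)
qed

lemma deriv_bound_near_real_point:
  fixes f v :: "complex \<Rightarrow> complex" and a :: "nat \<Rightarrow> complex" and y0 :: real
  assumes f: "f holomorphic_on ball 0 R" and v: "v holomorphic_on ball 0 R" and r: "0 < r" "r < R"
    and Im_a: "\<And>j. j < M \<Longrightarrow> Im (a j) < 0"
    and norm_a: "\<And>j. j < M \<Longrightarrow> norm (a j) \<le> r / 2"
    and real_bd: "\<And>y::real. \<bar>y\<bar> \<le> r \<Longrightarrow> norm (f (of_real y)) \<le> C * norm (\<Prod>j<M. of_real y - a j)"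
    and D: "\<And>y. norm y = r \<Longrightarrow> norm (f y) \<le> D" "D \<le> C * (r / 2) ^ M"
    and C: "C \<ge> 0"
    and c: "c > 0" "\<And>y. norm y \<le> r \<Longrightarrow> norm (v y) \<ge> c"
    and y0: "\<bar>y0\<bar> \<le> r / 2" and d: "0 < d" "d \<le> r / 2" "\<And>j. j < M \<Longrightarrow> d \<le> norm (of_real y0 - a j) / 2"
  shows "norm (deriv (\<lambda>y. f y / (v y * (\<Prod>j<M. y - a j))) (of_real y0)) \<le> C * 3 ^ M / c / d"
proof -
  let ?g = "\<lambda>y. f y / (v y * (\<Prod>j<M. y - a j))"
  have nr: "norm y \<le> r" if "norm (y - of_real y0) \<le> d" for y :: complex
    using that y0 d(2) norm_triangle_ineq[of "y - of_real y0" "of_real y0"] by simp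
  have nz: "(\<Prod>j<M. y - a j) \<noteq> 0" if "norm (y - of_real y0) \<le> d" for y :: complex
    using that d(1,3) by (force simp: norm_minus_commute)
  have sub: "cball (complex_of_real y0) d \<subseteq> ball 0 R"
    using nr r by (force simp: dist_norm norm_minus_commute)
  have hol: "?g holomorphic_on cball (of_real y0) d"
    using nz nr c
    by (intro holomorphic_intros holomorphic_on_subset[OF f sub] holomorphic_on_subset[OF v sub])
       (force simp: dist_norm norm_minus_commute)
  have "norm ((deriv ^^ 1) ?g (of_real y0)) \<le> fact 1 * (C * 3 ^ M / c) / d ^ 1"
  proof (rule Cauchy_inequality)
    show "?g holomorphic_on ball (of_real y0) d"
      using hol by (rule holomorphic_on_subset) auto
    show "continuous_on (cball (of_real y0) d) ?g"
      using hol by (rule holomorphic_on_imp_continuous_on)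
    fix y :: complex assume "norm (of_real y0 - y) = d"
    then have y: "norm (y - of_real y0) \<le> d" by (simp add: norm_minus_commute)
    have "norm (f y) \<le> C * 3 ^ M * norm (\<Prod>j<M. y - a j)"
      by (rule bound_near_real_point[OF f r Im_a norm_a real_bd D C y0 d(2,3) y])
    also have "\<dots> \<le> C * 3 ^ M * norm (\<Prod>j<M. y - a j) * (norm (v y) / c)"
      using c C nr[OF y] mult_left_mono[of 1 "norm (v y) / c" "C * 3 ^ M * norm (\<Prod>j<M. y - a j)"] by simp
    finally have "norm (f y) \<le> C * 3 ^ M / c * norm (v y * (\<Prod>j<M. y - a j))"
      by (simp add: norm_mult mult_ac)
    moreover have "norm (v y * (\<Prod>j<M. y - a j)) > 0"
      using nz[OF y] c(1) c(2)[OF nr[OF y]] by auto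
    ultimately show "norm (?g y) \<le> C * 3 ^ M / c"
      by (simp add: norm_divide pos_divide_le_eq)
  qed (rule d(1))
  then show ?thesis by simp
qed

subsection \<open>Convergent power series and the branches of \<open>P\<close>\<close>

lemma conv2_regular:
  assumes "conv2 F"
  obtains r where "r > 0"
    "continuous_on (ball 0 r \<times> ball 0 r) (\<lambda>z. F (fst z) (snd z))"
    "\<And>x. norm x < r \<Longrightarrow> F x holomorphic_on ball 0 r"
proof -
  obtain r0 a where r0: "r0 > 0" and sum': "\<forall>x y. cmod x < r0 \<longrightarrow> cmod y < r0 \<longrightarrow>
      ((\<lambda>(i,j). a (i,j) * x ^ i * y ^ j) has_sum F x y) UNIV"
    using assms[unfolded conv2_def] by (elim exE conjE) (rule that)
  have sum: "((\<lambda>(i,j). a (i,j) * x ^ i * y ^ j) has_sum F x y) UNIV" if "cmod x < r0" "cmod y < r0" for x y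
    using sum' that by simp
  define r where "r = r0 / 2"
  have r: "r > 0" "r < r0" using r0 by (auto simp: r_def)
  define m where "m = (\<lambda>(i::nat,j::nat). norm (a (i,j)) * r ^ i * r ^ j)"
  have "(\<lambda>(i,j). a (i,j) * complex_of_real r ^ i * complex_of_real r ^ j) summable_on UNIV"
    using sum[of "of_real r" "of_real r"] r by (auto simp: summable_on_def)
  then have "(\<lambda>z. norm ((\<lambda>(i,j). a (i,j) * complex_of_real r ^ i * complex_of_real r ^ j) z)) summable_on UNIV"
    by (simp add: summable_on_iff_abs_summable_on_complex)
  then have m: "m summable_on UNIV"
    using r by (simp add: m_def case_prod_unfold norm_mult norm_power)
  have le: "norm (a (i,j) * x ^ i * y ^ j) \<le> m (i,j)" if "norm x \<le> r" "norm y \<le> r" for i j x y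
    using that r unfolding m_def
    by (auto simp: norm_mult norm_power intro!: mult_mono power_mono)
  have ul: "uniform_limit Y (\<lambda>X z. \<Sum>(i,j)\<in>X. a (i,j) * f z ^ i * g z ^ j) (\<lambda>z. F (f z) (g z))
      (finite_subsets_at_top UNIV)"
    if "\<And>z. z \<in> Y \<Longrightarrow> norm (f z) \<le> r \<and> norm (g z) \<le> r" for Y :: "'a set" and f g
  proof (rule Weierstrass_m_test_general'[OF _ _ m])
    fix p z assume z: "z \<in> Y"
    show "norm (case p of (i, j) \<Rightarrow> a (i, j) * f z ^ i * g z ^ j) \<le> m p"
      using le that[OF z] by (cases p) simp
  next
    fix z assume z: "z \<in> Y"
    show "((\<lambda>p. case p of (i, j) \<Rightarrow> a (i, j) * f z ^ i * g z ^ j) has_sum F (f z) (g z)) UNIV"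
      using that[OF z] r by (intro sum) auto
  qed
  show ?thesis
  proof
    show "continuous_on (ball 0 r \<times> ball 0 r) (\<lambda>z. F (fst z) (snd z))"
    proof (rule uniform_limit_theorem[OF _ ul])
      show "\<forall>\<^sub>F X in finite_subsets_at_top UNIV. continuous_on (ball 0 r \<times> ball 0 r)
          (\<lambda>z. \<Sum>(i,j)\<in>X. a (i,j) * fst z ^ i * snd z ^ j)"
        by (intro always_eventually allI) (auto simp: case_prod_unfold intro!: continuous_intros)
    qed auto
    show "F x holomorphic_on ball 0 r" if "norm x < r" for x
    proof (rule holomorphic_uniform_limit[OF _ ul])
      show "\<forall>\<^sub>F X in finite_subsets_at_top UNIV.
          continuous_on (cball 0 r) (\<lambda>y. \<Sum>(i,j)\<in>X. a (i,j) * x ^ i * y ^ j) \<and>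
          (\<lambda>y. \<Sum>(i,j)\<in>X. a (i,j) * x ^ i * y ^ j) holomorphic_on ball 0 r"
        by (intro always_eventually allI conjI)
           (auto simp: case_prod_unfold intro!: continuous_intros holomorphic_intros)
    qed (use that in auto)
  qed (rule r)
qed

lemma conv1_isCont:
  assumes "conv1 f"
  shows "isCont f 0"
proof -
  obtain r a where r: "r > 0" and sum: "\<And>x. cmod x < r \<Longrightarrow> ((\<lambda>i. a i * x ^ i) has_sum f x) UNIV"
    using assms unfolding conv1_def by blast
  have sums: "(\<lambda>i. a i * x ^ i) sums f x" if "cmod x < r" for x
    using has_sum_imp_sums[OF sum[OF that]] .
  have "isCont (\<lambda>x. \<Sum>i. a i * x ^ i) 0"
    by (rule isCont_powser[of _ "of_real (r / 2)"]) (use r in \<open>auto intro!: sums_summable sums\<close>)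
  moreover have "\<forall>\<^sub>F x in nhds 0. f x = (\<Sum>i. a i * x ^ i)"
    using eventually_nhds_in_open[of "ball 0 r" "0::complex"] r
    by (auto elim!: eventually_mono dest!: sums simp: sums_iff)
  ultimately show ?thesis using isCont_cong[of f "\<lambda>x. \<Sum>i. a i * x ^ i" 0] by simp
qed

lemma real_root_branch:
  assumes "k \<ge> 1"
  obtains \<tau> :: "real \<Rightarrow> complex" where "\<And>x. \<tau> x ^ k = of_real x" "isCont \<tau> 0" "\<tau> 0 = 0"
proof -
  define \<tau> where "\<tau> x = of_real (root k \<bar>x\<bar>) * (if x \<ge> 0 then 1 else cis (pi / real k))" for x
  have \<tau>: "\<tau> x ^ k = of_real x" for x
  proof -
    have "cis (pi / real k) ^ k = cis pi" using assms by (simp add: Complex.DeMoivre)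
    then show ?thesis using assms by (auto simp: \<tau>_def power_mult_distrib simp flip: of_real_power)
  qed
  have norm: "norm (\<tau> x) = root k \<bar>x\<bar>" for x
    using assms by (simp add: \<tau>_def norm_mult real_root_ge_zero)
  have \<tau>0: "\<tau> 0 = 0" using norm[of 0] by simp
  have "((\<lambda>x. norm (\<tau> x)) \<longlongrightarrow> root k \<bar>0\<bar>) (at 0)"
    unfolding norm by (intro tendsto_intros)
  then have "(\<tau> \<longlongrightarrow> 0) (at 0)" by (simp add: tendsto_norm_zero_iff)
  with \<tau>0 have "isCont \<tau> 0" by (simp add: isCont_def)
  with \<tau> \<tau>0 show ?thesis using that by blast
qed

lemma root_estimates:
  fixes \<psi> :: "complex \<Rightarrow> complex" and \<tau> :: "real \<Rightarrow> complex" and q :: "real poly"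
  assumes \<psi>: "isCont \<psi> 0" and im: "Im (\<psi> 0) > 0" and \<tau>: "isCont \<tau> 0" "\<tau> 0 = 0"
    and L: "L > 0" and q: "poly q 0 = 0"
  defines "a \<equiv> \<lambda>x::real. - of_real (poly q x) - of_real (x ^ (2 * L)) * \<psi> (\<tau> x)"
  shows "(a \<longlongrightarrow> 0) (nhds 0)"
    and "\<exists>c>0. \<forall>\<^sub>F x in nhds 0. (x \<noteq> 0 \<longrightarrow> Im (a x) < 0) \<and>
      (\<forall>y. c * \<bar>y + poly q x\<bar> \<le> norm (of_real y - a x) \<and> c * \<bar>x\<bar> ^ (2 * L) \<le> norm (of_real y - a x))"
proof -
  have cont: "isCont (\<lambda>x. \<psi> (\<tau> x)) 0"
    using \<psi> \<tau> isCont_o2[of 0 \<tau> \<psi>] by simp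
  then have "isCont a 0" unfolding a_def by (intro continuous_intros)
  moreover have "a 0 = 0" using L q by (simp add: a_def)
  ultimately show "(a \<longlongrightarrow> 0) (nhds 0)"
    by (metis isCont_def tendsto_nhds_iff)
  define m where "m = Im (\<psi> 0) / 2"
  define B where "B = norm (\<psi> 0) + 1"
  define c where "c = 1 / (1 + (B + 1) / m)"
  have m: "m > 0" using im by (simp add: m_def)
  have B: "B > 0" unfolding B_def by (simp add: add_nonneg_pos)
  have c: "c > 0" using m B by (simp add: c_def add_pos_pos)
  have lim: "((\<lambda>x. \<psi> (\<tau> x)) \<longlongrightarrow> \<psi> 0) (nhds 0)"
    using cont \<tau>(2) by (metis isCont_def tendsto_nhds_iff)
  have "\<forall>\<^sub>F x in nhds 0. Im (\<psi> (\<tau> x)) > m"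
    using im by (intro order_tendstoD(1)[OF tendsto_Im[OF lim]]) (simp add: m_def)
  moreover have "\<forall>\<^sub>F x in nhds 0. norm (\<psi> (\<tau> x)) < B"
    by (intro order_tendstoD(2)[OF tendsto_norm[OF lim]]) (simp add: B_def)
  ultimately have "\<forall>\<^sub>F x in nhds 0. (x \<noteq> 0 \<longrightarrow> Im (a x) < 0) \<and>
      (\<forall>y. c * \<bar>y + poly q x\<bar> \<le> norm (of_real y - a x) \<and> c * \<bar>x\<bar> ^ (2 * L) \<le> norm (of_real y - a x))"
  proof eventually_elim
    case (elim x)
    define X where "X = x ^ (2 * L)"
    have X: "X \<ge> 0" "x \<noteq> 0 \<Longrightarrow> X > 0" "\<bar>x\<bar> ^ (2 * L) = X"
      by (simp_all add: X_def power_mult)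
    have "Im (a x) < 0" if "x \<noteq> 0"
      using X(2)[OF that] elim m by (simp add: a_def X_def[symmetric])
    moreover have "c * \<bar>y + poly q x\<bar> \<le> norm (of_real y - a x) \<and> c * X \<le> norm (of_real y - a x)" for y
    proof -
      let ?w = "of_real y - a x"
      have "Im ?w = X * Im (\<psi> (\<tau> x))" by (simp add: a_def X_def[symmetric])
      moreover have "X * m \<le> X * Im (\<psi> (\<tau> x))" using X elim by (intro mult_left_mono) auto
      ultimately have "X * m \<le> norm ?w" using abs_Im_le_cmod[of ?w] by linarith
      then have 1: "X \<le> norm ?w / m" using m by (simp add: field_simps)
      have "\<bar>y + poly q x\<bar> = norm (?w - of_real X * \<psi> (\<tau> x))"
        unfolding a_def X_def[symmetric] by (simp flip: of_real_add)
      also have "\<dots> \<le> norm ?w + X * B"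
        using norm_triangle_ineq4[of ?w "of_real X * \<psi> (\<tau> x)"] X elim
          mult_left_mono[of "norm (\<psi> (\<tau> x))" B X] by (simp add: norm_mult)
      also have "\<dots> \<le> norm ?w + norm ?w / m * B"
        using 1 B by (intro add_left_mono mult_right_mono) auto
      finally have 2: "\<bar>y + poly q x\<bar> \<le> norm ?w + norm ?w / m * B" .
      have "norm ?w / c = norm ?w + norm ?w / m * B + norm ?w / m"
        using m by (simp add: c_def field_simps)
      then have "\<bar>y + poly q x\<bar> \<le> norm ?w / c" "X \<le> norm ?w / c"
        using 1 2 m B X by (smt (verit) divide_nonneg_pos mult_nonneg_nonneg norm_ge_zero)+
      then show ?thesis using c by (simp add: field_simps)
    qed
    ultimately show ?case using X(3) by auto
  qed
  with c show "\<exists>c>0. \<forall>\<^sub>F x in nhds 0. (x \<noteq> 0 \<longrightarrow> Im (a x) < 0) \<and>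
      (\<forall>y. c * \<bar>y + poly q x\<bar> \<le> norm (of_real y - a x) \<and> c * \<bar>x\<bar> ^ (2 * L) \<le> norm (of_real y - a x))"
    by blast
qed

lemma exponents_positive:
  fixes u :: "complex \<Rightarrow> complex" and c :: "nat \<Rightarrow> complex" and L :: "nat \<Rightarrow> nat"
  assumes u: "u holomorphic_on ball 0 r" "r > 0" "u 0 \<noteq> 0"
    and c: "\<And>j. j < M \<Longrightarrow> c j \<noteq> 0"
    and f: "\<forall>\<^sub>F y in nhds 0. f y = u y * (\<Prod>j<M. y + 0 ^ (2 * L j) * c j)"
    and M: "int M = zorder f 0" and j: "j < M"
  shows "L j > 0"
proof -
  obtain e where e: "e > 0" "\<And>y. norm y < e \<Longrightarrow> f y = u y * (\<Prod>j<M. y + 0 ^ (2 * L j) * c j)"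
    using f unfolding eventually_nhds_metric by (auto simp: dist_norm)
  define A where "A = {j. j < M \<and> L j = 0}"
  define B where "B = {j. j < M \<and> L j > 0}"
  have AB: "{..<M} = A \<union> B" "A \<inter> B = {}" "finite A" "finite B" by (auto simp: A_def B_def)
  have prod: "(\<Prod>j<M. y + 0 ^ (2 * L j) * c j) = (\<Prod>j\<in>A. y + c j) * y ^ card B" for y
  proof -
    have "(\<Prod>j\<in>A. y + 0 ^ (2 * L j) * c j) = (\<Prod>j\<in>A. y + c j)"
      by (intro prod.cong) (auto simp: A_def)
    moreover have "(\<Prod>j\<in>B. y + 0 ^ (2 * L j) * c j) = (\<Prod>j\<in>B. y)"
      by (intro prod.cong) (auto simp: B_def)
    ultimately show ?thesis by (simp add: AB prod.union_disjoint)
  qed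
  have "zorder f 0 = int (card B)"
  proof (rule zorder_eqI[of "ball 0 (min e r)" 0 "\<lambda>y. u y * (\<Prod>j\<in>A. y + c j)"])
    show "(\<lambda>y. u y * (\<Prod>j\<in>A. y + c j)) holomorphic_on ball 0 (min e r)"
      by (intro holomorphic_intros holomorphic_on_subset[OF u(1)]) auto
    show "u 0 * (\<Prod>j\<in>A. 0 + c j) \<noteq> 0" using u c AB by (auto simp: A_def)
    fix w :: complex assume "w \<in> ball 0 (min e r)"
    then show "f w = u w * (\<Prod>j\<in>A. w + c j) * (w - 0) powi int (card B)"
      by (simp add: e(2) prod mult.assoc)
  qed (use e u in auto)
  with M have "card B = card {..<M}" by simp
  moreover have "B \<subseteq> {..<M}" by (auto simp: B_def)
  ultimately have "B = {..<M}" by (metis card_subset_eq finite_lessThan)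
  then show ?thesis using j by (auto simp: B_def)
qed

lemma eventually_nhds_box:
  fixes Pr :: "'a::real_normed_vector \<Rightarrow> 'b::real_normed_vector \<Rightarrow> bool"
  assumes "\<forall>\<^sub>F z in nhds (0,0). Pr (fst z) (snd z)"
  obtains e where "e > 0" "\<And>x y. norm x < e \<Longrightarrow> norm y < e \<Longrightarrow> Pr x y"
proof -
  obtain A B where A: "\<forall>\<^sub>F x in nhds 0. A x" and B: "\<forall>\<^sub>F y in nhds 0. B y"
    and AB: "\<And>x y. A x \<Longrightarrow> B y \<Longrightarrow> Pr x y"
    using assms unfolding nhds_prod eventually_prod_filter by auto
  obtain e1 e2 where "e1 > 0" "\<And>x. norm x < e1 \<Longrightarrow> A x" "e2 > 0" "\<And>y. norm y < e2 \<Longrightarrow> B y"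
    using A B unfolding eventually_nhds_metric by (auto simp: dist_norm)
  then show ?thesis using AB by (intro that[of "min e1 e2"]) auto
qed

definition tame_polydisc :: "(complex \<Rightarrow> complex \<Rightarrow> complex) \<Rightarrow> real \<Rightarrow> real \<Rightarrow> bool" where
  "tame_polydisc F \<epsilon> R \<longleftrightarrow> continuous_on (ball 0 R \<times> ball 0 R) (\<lambda>z. F (fst z) (snd z)) \<and>
    (\<forall>x. norm x < R \<longrightarrow> F x holomorphic_on ball 0 R) \<and>
    (\<forall>x y. norm x < R \<longrightarrow> norm y < R \<longrightarrow> norm (F x y - F 0 0) < \<epsilon>)"

lemma eventually_tame_polydisc:
  assumes "conv2 F" "\<epsilon> > 0"
  shows "\<forall>\<^sub>F R in at_right 0. tame_polydisc F \<epsilon> R"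
proof -
  obtain r where r: "r > 0" "continuous_on (ball 0 r \<times> ball 0 r) (\<lambda>z. F (fst z) (snd z))"
    "\<And>x. norm x < r \<Longrightarrow> F x holomorphic_on ball 0 r"
    using conv2_regular[OF assms(1)] by blast
  have "isCont (\<lambda>z. F (fst z) (snd z)) (0,0)"
    using r by (subst (asm) continuous_on_eq_continuous_at) (auto intro: open_Times)
  then have "((\<lambda>z. F (fst z) (snd z)) \<longlongrightarrow> F 0 0) (nhds (0,0))"
    by (simp add: isCont_def tendsto_nhds_iff)
  then have "\<forall>\<^sub>F z in nhds (0,0). norm (F (fst z) (snd z) - F 0 0) < \<epsilon>"
    using assms(2) unfolding tendsto_iff dist_norm by auto
  then obtain e where e: "e > 0" "\<And>x y. norm x < e \<Longrightarrow> norm y < e \<Longrightarrow> norm (F x y - F 0 0) < \<epsilon>"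
    using eventually_nhds_box[of "\<lambda>x y. norm (F x y - F 0 0) < \<epsilon>"] by blast
  show ?thesis unfolding eventually_at_right_field tame_polydisc_def
  proof (intro exI[of _ "min r e"] conjI allI impI)
    fix R assume R: "0 < R" "R < min r e"
    show "continuous_on (ball 0 R \<times> ball 0 R) (\<lambda>z. F (fst z) (snd z))"
      using R by (intro continuous_on_subset[OF r(2)]) auto
    show "F x holomorphic_on ball 0 R" if "norm x < R" for x
      using R that by (intro holomorphic_on_subset[OF r(3)]) auto
    show "norm (F x y - F 0 0) < \<epsilon>" if "norm x < R" "norm y < R" for x y
      using R that by (intro e(2)) auto
  qed (use r e in auto)
qed

lemma poly_map_poly_of_real:
  "poly (map_poly complex_of_real q) (of_real x) = of_real (poly q x)"
  by (simp add: poly_altdef degree_map_poly coeff_map_poly)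

lemma ex_distance_to_roots:
  fixes a :: "nat \<Rightarrow> complex"
  assumes "\<rho> > 0" "\<And>j. j < M \<Longrightarrow> w \<noteq> a j"
  obtains d where "d > 0" "d \<le> \<rho>" "\<And>j. j < M \<Longrightarrow> d \<le> norm (w - a j) / 2"
    "d = \<rho> \<or> (\<exists>j<M. d = norm (w - a j) / 2)"
proof -
  let ?D = "insert \<rho> ((\<lambda>j. norm (w - a j) / 2) ` {..<M})"
  have "Min ?D \<in> ?D" by (intro Min_in) auto
  then have "Min ?D = \<rho> \<or> (\<exists>j<M. Min ?D = norm (w - a j) / 2)" by auto
  moreover from this have "Min ?D > 0" using assms by auto
  moreover have "Min ?D \<le> norm (w - a j) / 2" if "j < M" for j
    using that by (intro Min_le) auto
  moreover have "Min ?D \<le> \<rho>" by (intro Min_le) auto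
  ultimately show ?thesis by (intro that[of "Min ?D"]) simp_all
qed

subsection \<open>Integrability\<close>

lemma nn_integral_abs_powr_finite:
  fixes \<alpha> c :: real
  assumes "\<alpha> < 1" "c \<ge> 0"
  shows "(\<integral>\<^sup>+t. ennreal (\<bar>t\<bar> powr (-\<alpha>) * indicator {-c..c} t) \<partial>lborel) < \<infinity>"
proof -
  define f where "f t = t powr (-\<alpha>) * indicator {0..c} t" for t :: real
  have [measurable]: "f \<in> borel_measurable borel" unfolding f_def by measurable
  have "((\<lambda>t. t powr (-\<alpha>)) has_integral (c powr (-\<alpha>+1) / (-\<alpha>+1))) {0..c}"
    using assms by (intro has_integral_powr_from_0) auto
  then have "(f has_integral (c powr (-\<alpha>+1) / (-\<alpha>+1))) UNIV"
    by (subst (asm) has_integral_restrict_UNIV[symmetric])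
       (auto simp: f_def indicator_def elim!: has_integral_eq[rotated])
  then have fin: "(\<integral>\<^sup>+t. ennreal (f t) \<partial>lborel) < \<infinity>"
    by (subst nn_integral_has_integral_lborel) (auto simp: f_def)
  have "(\<integral>\<^sup>+t. ennreal (\<bar>t\<bar> powr (-\<alpha>) * indicator {-c..c} t) \<partial>lborel)
      \<le> (\<integral>\<^sup>+t. ennreal (f t) + ennreal (f (0 + (-1) * t)) \<partial>lborel)"
    by (intro nn_integral_mono) (auto simp: f_def indicator_def abs_if)
  also have "\<dots> = (\<integral>\<^sup>+t. ennreal (f t) \<partial>lborel) + (\<integral>\<^sup>+t. ennreal (f (0 + (-1) * t)) \<partial>lborel)"
    by (rule nn_integral_add) auto
  also have "(\<integral>\<^sup>+t. ennreal (f (0 + (-1) * t)) \<partial>lborel) = (\<integral>\<^sup>+t. ennreal (f t) \<partial>lborel)"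
    using nn_integral_real_affine[of "\<lambda>t. ennreal (f t)" "-1" 0] by simp
  finally show ?thesis using fin by (simp add: order_le_less_trans)
qed

lemma nn_integral_curve_powr_finite:
  fixes \<alpha> \<beta> s :: real and q :: "real poly"
  assumes \<alpha>: "\<alpha> < 1" and \<beta>: "\<beta> < 1" and s: "s \<ge> 0"
  shows "(\<integral>\<^sup>+z. ennreal (\<bar>snd z + poly q (fst z)\<bar> powr (-\<alpha>) * \<bar>fst z\<bar> powr (-\<beta>)
            * indicator ({-s<..<s} \<times> {-s<..<s}) z) \<partial>lborel) < \<infinity>"
proof -
  have "continuous_on {-s..s} (poly q)" by (intro continuous_intros)
  then have "compact (poly q ` {-s..s})" by (intro compact_continuous_image) auto
  then obtain b where b: "\<And>x. x \<in> {-s..s} \<Longrightarrow> \<bar>poly q x\<bar> \<le> b"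
    using compact_imp_bounded bounded_iff by (metis imageI real_norm_def)
  have "b \<ge> 0" using b[of 0] s by auto
  define c where "c = b + s"
  have c: "c \<ge> 0" using \<open>b \<ge> 0\<close> s by (simp add: c_def)
  define h where "h t = \<bar>t\<bar> powr (-\<alpha>) * indicator {-c..c} t" for t :: real
  define g where "g t = \<bar>t\<bar> powr (-\<beta>) * indicator {-s..s} t" for t :: real
  have poly_meas [measurable]: "poly q \<in> borel_measurable borel"
    by (intro borel_measurable_continuous_onI continuous_intros)
  have [measurable]: "h \<in> borel_measurable borel" "g \<in> borel_measurable borel"
    unfolding h_def g_def by measurable
  have nonneg: "h t \<ge> 0" "g t \<ge> 0" for t by (simp_all add: h_def g_def)
  have "(\<integral>\<^sup>+z. ennreal (\<bar>snd z + poly q (fst z)\<bar> powr (-\<alpha>) * \<bar>fst z\<bar> powr (-\<beta>)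
            * indicator ({-s<..<s} \<times> {-s<..<s}) z) \<partial>lborel)
      \<le> (\<integral>\<^sup>+z. ennreal (g (fst z)) * ennreal (h (poly q (fst z) + 1 * snd z)) \<partial>lborel)"
  proof (rule nn_integral_mono)
    fix z :: "real \<times> real"
    have "\<bar>snd z + poly q (fst z)\<bar> \<le> c" if "fst z \<in> {-s<..<s}" "snd z \<in> {-s<..<s}"
      using b[of "fst z"] that by (auto simp: c_def)
    then have "\<bar>snd z + poly q (fst z)\<bar> powr (-\<alpha>) * \<bar>fst z\<bar> powr (-\<beta>)
            * indicator ({-s<..<s} \<times> {-s<..<s}) z \<le> g (fst z) * h (poly q (fst z) + 1 * snd z)"
      by (cases z) (auto simp: g_def h_def indicator_def mem_Times_iff add.commute)
    then show "ennreal (\<bar>snd z + poly q (fst z)\<bar> powr (-\<alpha>) * \<bar>fst z\<bar> powr (-\<beta>)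
            * indicator ({-s<..<s} \<times> {-s<..<s}) z) \<le> ennreal (g (fst z)) * ennreal (h (poly q (fst z) + 1 * snd z))"
      using nonneg by (metis ennreal_leI ennreal_mult)
  qed
  also have "\<dots> = (\<integral>\<^sup>+z. ennreal (g (fst z)) * ennreal (h (poly q (fst z) + 1 * snd z)) \<partial>(lborel \<Otimes>\<^sub>M lborel))"
    by (simp add: lborel_prod)
  also have "\<dots> = (\<integral>\<^sup>+x. (\<integral>\<^sup>+y. ennreal (g x) * ennreal (h (poly q x + 1 * y)) \<partial>lborel) \<partial>lborel)"
    by (subst lborel.nn_integral_fst[symmetric]) (auto simp: case_prod_unfold)
  also have "\<dots> = (\<integral>\<^sup>+x. ennreal (g x) * (\<integral>\<^sup>+y. ennreal (h (poly q x + 1 * y)) \<partial>lborel) \<partial>lborel)"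
    by (intro nn_integral_cong nn_integral_cmult) auto
  also have "\<dots> = (\<integral>\<^sup>+x. ennreal (g x) * (\<integral>\<^sup>+y. ennreal (h y) \<partial>lborel) \<partial>lborel)"
    using nn_integral_real_affine[of "\<lambda>y. ennreal (h y)" 1] by simp
  also have "\<dots> = (\<integral>\<^sup>+x. ennreal (g x) \<partial>lborel) * (\<integral>\<^sup>+y. ennreal (h y) \<partial>lborel)"
    by (rule nn_integral_multc) auto
  also have "\<dots> < \<infinity>"
    using nn_integral_abs_powr_finite[OF \<alpha> c] nn_integral_abs_powr_finite[OF \<beta> s]
    by (simp add: h_def g_def ennreal_mult_less_top)
  finally show ?thesis .
qed

lemma powr_interpolation:
  fixes N B X Y p \<alpha> :: real
  assumes "N * X \<le> B" "N * Y \<le> B" "N \<ge> 0" "X > 0" "Y > 0" "0 \<le> \<alpha>" "\<alpha> \<le> p"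
  shows "N powr p \<le> B powr p * X powr (-\<alpha>) * Y powr (-(p - \<alpha>))"
proof -
  have B: "B \<ge> 0" using assms by (metis mult_nonneg_nonneg order.trans less_imp_le)
  have "N powr p = N powr \<alpha> * N powr (p - \<alpha>)" by (simp flip: powr_add)
  also have "\<dots> \<le> (B / X) powr \<alpha> * (B / Y) powr (p - \<alpha>)"
    using assms by (intro mult_mono powr_mono2) (auto simp: field_simps)
  also have "\<dots> = (B powr \<alpha> * B powr (p - \<alpha>)) * X powr (-\<alpha>) * Y powr (-(p - \<alpha>))"
    using assms B by (simp add: powr_divide powr_minus_divide del: minus_diff_eq)
  finally show ?thesis by (simp flip: powr_add)
qed

text \<open>Splitting \<open>p = \<alpha> + (p - \<alpha>)\<close> with \<open>\<alpha> < 1\<close> and \<open>K (p - \<alpha>) < 1\<close> and spending the two bounds on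
  the two parts decouples the variables, so that Tonelli applies.\<close>
lemma integrable_powr_of_root_bounds:
  fixes F :: "real \<times> real \<Rightarrow> complex" and q :: "nat \<Rightarrow> real poly" and L :: "nat \<Rightarrow> nat"
  assumes s: "0 < s" "s \<le> 1"
    and F: "F \<in> borel_measurable (lebesgue_on ({-s<..<s} \<times> {-s<..<s}))"
    and bd: "\<And>x y. \<bar>x\<bar> < s \<Longrightarrow> \<bar>y\<bar> < s \<Longrightarrow> x \<noteq> 0 \<Longrightarrow> norm (F (x,y)) \<le> B \<or>
       (\<exists>j<M. norm (F (x,y)) * \<bar>y + poly (q j) x\<bar> \<le> B \<and> norm (F (x,y)) * \<bar>x\<bar> ^ (2 * L j) \<le> B)"
    and K: "\<And>j. j < M \<Longrightarrow> 0 < 2 * L j \<and> 2 * L j \<le> K"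
    and p: "1 \<le> p" "real K * p < real K + 1"
  shows "integrable (lebesgue_on ({-s<..<s} \<times> {-s<..<s})) (\<lambda>z. norm (F z) powr p)"
proof -
  let ?S = "{-s<..<s} \<times> {-s<..<s} :: (real \<times> real) set"
  have S: "?S \<in> sets lebesgue" by (intro borel_open[THEN sets_completionI_sets[of _ lborel, simplified]] open_Times) auto
  obtain \<alpha> where \<alpha>: "0 \<le> \<alpha>" "\<alpha> < 1" "real K * (p - \<alpha>) < 1"
  proof (cases "K = 0")
    case True
    then show ?thesis using that[of 0] by simp
  next
    case False
    define \<alpha> where "\<alpha> = max 0 ((1 + (p - 1 / K)) / 2)"
    have "p - 1 / K < 1" using p False by (simp add: field_simps)
    moreover from this have "p - 1 / K < \<alpha>" unfolding \<alpha>_def less_max_iff_disj by simp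
    ultimately show ?thesis using False by (intro that[of \<alpha>]) (auto simp: \<alpha>_def field_simps)
  qed
  define \<beta> where "\<beta> = real K * (p - \<alpha>)"
  have \<beta>: "\<beta> < 1" using \<alpha> by (simp add: \<beta>_def)
  define G where "G j z = \<bar>snd z + poly (q j) (fst z)\<bar> powr (-\<alpha>) * \<bar>fst z\<bar> powr (-\<beta>) * indicator ?S z"
    for j :: nat and z :: "real \<times> real"
  have poly_meas [measurable]: "poly (q j) \<in> borel_measurable borel" for j
    by (intro borel_measurable_continuous_onI continuous_intros)
  have S_borel [measurable]: "?S \<in> sets borel" by (intro borel_open open_Times) auto
  have "bounded ?S" by (intro bounded_Times) auto
  then have emeasure_S: "emeasure lborel ?S < \<infinity>" by (rule emeasure_bounded_finite)
  have G_meas [measurable]: "G j \<in> borel_measurable borel" for j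
  proof -
    have [measurable]: "(\<lambda>z::real\<times>real. fst z) \<in> borel_measurable borel" "(\<lambda>z::real\<times>real. snd z) \<in> borel_measurable borel"
      by (intro borel_measurable_continuous_onI continuous_intros)+
    show ?thesis unfolding G_def by measurable
  qed
  have G0: "G j z \<ge> 0" for j z by (simp add: G_def)
  have null_x: "AE z in (lborel :: (real \<times> real) measure). fst z \<noteq> 0"
    unfolding lborel_prod[symmetric]
  proof (rule lborel_pair.AE_pair_measure)
    show "AE x in lborel. AE y in lborel. fst (x, y) \<noteq> (0::real)"
      using AE_lborel_singleton[of "0::real"] by eventually_elim simp
  qed measurable
  have null_q: "AE z in (lborel :: (real \<times> real) measure). \<forall>j\<in>{..<M}. snd z + poly (q j) (fst z) \<noteq> 0"
    unfolding lborel_prod[symmetric]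
  proof (rule AE_finite_allI)
    fix j
    show "AE z in lborel \<Otimes>\<^sub>M lborel. snd z + poly (q j) (fst z) \<noteq> 0"
    proof (rule lborel_pair.AE_pair_measure)
      have "AE y in lborel. snd (x, y) + poly (q j) (fst (x, y)) \<noteq> 0" for x
        using AE_lborel_singleton[of "- poly (q j) x"] by eventually_elim auto
      then show "AE x in lborel. AE y in lborel. snd (x, y) + poly (q j) (fst (x, y)) \<noteq> 0" by simp
    qed measurable
  qed simp
  show ?thesis
  proof (rule integrableI_bounded)
    show "(\<lambda>z. norm (F z) powr p) \<in> borel_measurable (lebesgue_on ?S)"
      using F by measurable
    have "(\<integral>\<^sup>+z. ennreal (norm (norm (F z) powr p)) \<partial>lebesgue_on ?S)
        = (\<integral>\<^sup>+z. ennreal (norm (F z) powr p) * indicator ?S z \<partial>lebesgue)"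
      using S by (simp add: nn_integral_restrict_space)
    also have "\<dots> \<le> (\<integral>\<^sup>+z. ennreal (B powr p * indicator ?S z) + (\<Sum>j<M. ennreal (B powr p * G j z)) \<partial>lebesgue)"
    proof (rule nn_integral_mono_AE)
      show "AE z in lebesgue. ennreal (norm (F z) powr p) * indicator ?S z
          \<le> ennreal (B powr p * indicator ?S z) + (\<Sum>j<M. ennreal (B powr p * G j z))"
        using AE_completion[OF null_x] AE_completion[OF null_q]
      proof eventually_elim
        case (elim z)
        obtain x y where z: "z = (x,y)" by (cases z)
        show ?case
        proof (cases "z \<in> ?S")
          case True
          then have xy: "\<bar>x\<bar> < s" "\<bar>y\<bar> < s" by (auto simp: z)
          have x0: "\<bar>x\<bar> > 0" using elim by (simp add: z)
          from bd[OF xy] x0 consider "norm (F z) \<le> B" |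
            j where "j < M" "norm (F z) * \<bar>y + poly (q j) x\<bar> \<le> B" "norm (F z) * \<bar>x\<bar> ^ (2 * L j) \<le> B"
            by (auto simp: z)
          then show ?thesis
          proof cases
            case 1
            then have "norm (F z) powr p \<le> B powr p" using p by (intro powr_mono2) auto
            with True have "ennreal (norm (F z) powr p) * indicator ?S z \<le> ennreal (B powr p * indicator ?S z)"
              by (simp add: ennreal_leI)
            then show ?thesis by (rule order_trans) simp
          next
            case (2 j)
            have "norm (F z) powr p \<le> B powr p * \<bar>y + poly (q j) x\<bar> powr (-\<alpha>) * (\<bar>x\<bar> ^ (2 * L j)) powr (-(p - \<alpha>))"
              using 2 elim x0 \<alpha> p by (intro powr_interpolation) (auto simp: z)
            also have "(\<bar>x\<bar> ^ (2 * L j)) powr (-(p - \<alpha>)) = \<bar>x\<bar> powr (- (real (2 * L j) * (p - \<alpha>)))"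
              using x0 by (simp add: powr_powr flip: powr_realpow) (simp add: algebra_simps)
            also have "\<dots> \<le> \<bar>x\<bar> powr (-\<beta>)"
            proof (rule powr_mono')
              have "real (2 * L j) \<le> real K" using K[OF 2(1)] by (intro of_nat_mono) simp
              then show "- \<beta> \<le> - (real (2 * L j) * (p - \<alpha>))"
                using \<alpha> p unfolding \<beta>_def by (simp add: mult_right_mono del: of_nat_mult)
            qed (use xy s in auto)
            finally have "norm (F z) powr p \<le> B powr p * G j z"
              using True by (simp add: G_def z mult.assoc mult_left_mono)
            then have "ennreal (norm (F z) powr p) * indicator ?S z \<le> ennreal (B powr p * G j z)"
              using True by (simp add: ennreal_leI)
            also have "\<dots> \<le> (\<Sum>j<M. ennreal (B powr p * G j z))"
              using 2(1) by (intro member_le_sum) auto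
            finally show ?thesis by (rule order_trans) simp
          qed
        qed simp
      qed
    qed
    also have "\<dots> = (\<integral>\<^sup>+z. ennreal (B powr p * indicator ?S z) + (\<Sum>j<M. ennreal (B powr p * G j z)) \<partial>lborel)"
      by (rule nn_integral_completion)
    also have "\<dots> = (\<integral>\<^sup>+z. ennreal (B powr p * indicator ?S z) \<partial>lborel) + (\<Sum>j<M. \<integral>\<^sup>+z. ennreal (B powr p * G j z) \<partial>lborel)"
      by (subst nn_integral_add) (auto intro!: nn_integral_sum)
    also have "\<dots> < \<infinity>"
    proof -
      have "(\<integral>\<^sup>+z. ennreal (B powr p * indicator ?S z) \<partial>lborel) < \<infinity>"
        using emeasure_S by (simp add: ennreal_mult ennreal_indicator nn_integral_cmult ennreal_mult_less_top)
      moreover have "(\<integral>\<^sup>+z. ennreal (B powr p * G j z) \<partial>lborel) < \<infinity>" for j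
        using nn_integral_curve_powr_finite[OF \<alpha>(2) \<beta>, of s "q j"] s
        by (simp add: ennreal_mult G0 nn_integral_cmult ennreal_mult_less_top flip: G_def)
      ultimately show ?thesis by simp
    qed
    finally show "(\<integral>\<^sup>+z. ennreal (norm (norm (F z) powr p)) \<partial>lebesgue_on ?S) < \<infinity>" .
  qed
qed

subsection \<open>The derivative along the second variable\<close>

lemma has_vector_derivative_real_restriction:
  assumes "g holomorphic_on S" "open S" "complex_of_real y \<in> S"
  shows "((\<lambda>t. g (of_real t)) has_vector_derivative deriv g (of_real y)) (at y)"
proof -
  have "(g has_field_derivative deriv g (of_real y)) (at (of_real y))"
    using assms holomorphic_derivI by blast
  then have "(g \<circ> of_real has_vector_derivative 1 * deriv g (of_real y)) (at y)"
    by (intro field_vector_diff_chain_at) (auto intro!: derivative_eq_intros)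
  then show ?thesis by (simp add: o_def)
qed

lemma LIMSEQ_difference_quotient:
  fixes g :: "real \<Rightarrow> 'a::real_normed_vector"
  assumes "(g has_vector_derivative D) (at y)"
  shows "(\<lambda>n. real (Suc n) *\<^sub>R (g (y + 1 / real (Suc n)) - g y)) \<longlonglongrightarrow> D"
proof -
  have "((\<lambda>h. (g (y + h) - g y) /\<^sub>R h) \<longlongrightarrow> D) (at 0)"
  proof (rule LIM_zero_cancel, rule tendsto_norm_zero_cancel)
    have "((\<lambda>h. norm (g (y + h) - g y - h *\<^sub>R D) / norm h) \<longlongrightarrow> 0) (at 0)"
      using assms by (simp add: has_vector_derivative_def has_derivative_at)
    moreover have "norm (g (y + h) - g y - h *\<^sub>R D) / norm h = norm ((g (y + h) - g y) /\<^sub>R h - D)"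
      if "h \<noteq> 0" for h
    proof -
      have "(g (y + h) - g y) /\<^sub>R h - D = (g (y + h) - g y - h *\<^sub>R D) /\<^sub>R h"
        using that by (simp add: scaleR_diff_right)
      then show ?thesis by (simp add: divide_inverse_commute)
    qed
    ultimately show "((\<lambda>h. norm ((g (y + h) - g y) /\<^sub>R h - D)) \<longlongrightarrow> 0) (at 0)"
      by (subst filterlim_cong[OF refl refl]) (auto simp: eventually_at_filter)
  qed
  moreover have "filterlim (\<lambda>n. 1 / real (Suc n)) (at 0) sequentially"
    using LIMSEQ_inverse_real_of_nat by (auto simp: filterlim_at inverse_eq_divide)
  ultimately have "(\<lambda>n. (g (y + 1 / real (Suc n)) - g y) /\<^sub>R (1 / real (Suc n))) \<longlonglongrightarrow> D"
    by (rule filterlim_compose)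
  then show ?thesis by simp
qed

lemma dy_measurable:
  fixes f :: "real \<times> real \<Rightarrow> complex"
  assumes S: "open S" and f: "continuous_on (S - {z0}) f"
    and diff: "\<And>z. z \<in> S - {z0} \<Longrightarrow> (\<lambda>t. f (fst z, t)) differentiable at (snd z)"
  shows "dy f \<in> borel_measurable (lebesgue_on S)"
proof -
  define \<Omega> where "\<Omega> = S - {z0}"
  have \<Omega>: "open \<Omega>" unfolding \<Omega>_def using S by (simp add: open_delete)
  define F where "F z = indicator \<Omega> z *\<^sub>R f z" for z
  have F [measurable]: "F \<in> borel_measurable borel"
    unfolding F_def using \<Omega> f by (intro borel_measurable_continuous_on_indicator) (auto simp: \<Omega>_def)
  define h where "h n z = indicator \<Omega> z *\<^sub>R (real (Suc n) *\<^sub>R (F (fst z, snd z + 1 / real (Suc n)) - F z))"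
    for n and z :: "real \<times> real"
  define g where "g z = indicator \<Omega> z *\<^sub>R dy f z" for z
  have shift: "(\<lambda>z::real\<times>real. (fst z, snd z + c)) \<in> borel_measurable borel" for c
    by (intro borel_measurable_continuous_onI continuous_intros)
  have h: "h n \<in> borel_measurable borel" for n
  proof -
    have [measurable]: "(\<lambda>z. F (fst z, snd z + 1 / real (Suc n))) \<in> borel_measurable borel"
      using measurable_compose[OF shift F] .
    have [measurable]: "\<Omega> \<in> sets borel" using \<Omega> by simp
    show ?thesis unfolding h_def by measurable
  qed
  have "(\<lambda>n. h n z) \<longlonglongrightarrow> g z" for z
  proof (cases "z \<in> \<Omega>")
    case True
    have "((\<lambda>t. f (fst z, t)) has_vector_derivative dy f z) (at (snd z))"
      using diff True unfolding dy_def \<Omega>_def by (simp flip: vector_derivative_works)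
    then have lim: "(\<lambda>n. real (Suc n) *\<^sub>R (f (fst z, snd z + 1 / real (Suc n)) - f (fst z, snd z))) \<longlonglongrightarrow> dy f z"
      by (rule LIMSEQ_difference_quotient)
    have "(\<lambda>n. (fst z, snd z + 1 / real (Suc n))) \<longlonglongrightarrow> (fst z, snd z + 0)"
      using LIMSEQ_inverse_real_of_nat by (intro tendsto_intros) (simp add: inverse_eq_divide)
    then have "\<forall>\<^sub>F n in sequentially. (fst z, snd z + 1 / real (Suc n)) \<in> \<Omega>"
      using True \<Omega> by (intro topological_tendstoD) auto
    then have "\<forall>\<^sub>F n in sequentially. real (Suc n) *\<^sub>R (f (fst z, snd z + 1 / real (Suc n)) - f (fst z, snd z)) = h n z"
      by eventually_elim (use True in \<open>simp add: h_def F_def\<close>)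
    with lim show ?thesis using True by (simp add: g_def filterlim_cong)
  qed (simp add: h_def g_def)
  then have "g \<in> borel_measurable borel"
    by (intro borel_measurable_LIMSEQ_metric[OF h])
  then have "g \<in> borel_measurable (lebesgue_on S)"
    by (intro measurable_restrict_space1 measurable_completion) simp
  then show ?thesis
  proof (rule measurable_discrete_difference[where X = "{z0} \<inter> S"])
    show "{x} \<in> sets (lebesgue_on S)" if "x \<in> {z0} \<inter> S" for x
      using that S by (auto simp: sets_restrict_space_iff)
  qed (auto simp: g_def \<Omega>_def)
qed

lemma AE_bound_imp_bound_on_open:
  fixes f :: "'a::euclidean_space \<Rightarrow> 'b::real_normed_vector"
  assumes U: "open U" and W: "open W" "W \<subseteq> U" and f: "continuous_on W f"
    and AE: "AE z in lebesgue_on U. norm (f z) \<le> C" and z: "z \<in> W"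
  shows "norm (f z) \<le> C"
proof (rule ccontr)
  assume "\<not> norm (f z) \<le> C"
  define N where "N = W \<inter> (\<lambda>z. norm (f z)) -` {C<..}"
  have "open N" unfolding N_def
    using W f by (intro continuous_open_preimage continuous_intros) auto
  moreover have "AE z in lebesgue. z \<notin> N"
    using AE U W by (subst (asm) AE_restrict_space_iff) (auto simp: N_def elim!: eventually_mono)
  then have "negligible N"
    using \<open>open N\<close> by (simp add: negligible_iff_null_sets AE_iff_null_sets)
  ultimately have "N = {}" using open_not_negligible by blast
  with z \<open>\<not> norm (f z) \<le> C\<close> show False by (auto simp: N_def)
qed

theorem theorem6p3:
  fixes P Q u :: "complex \<Rightarrow> complex \<Rightarrow> complex"
    and M k :: nat and L :: "nat \<Rightarrow> nat" and q :: "nat \<Rightarrow> real poly"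
    and \<psi> :: "nat \<Rightarrow> complex \<Rightarrow> complex"
  assumes P_conv: "conv2 P"
    and P0: "\<not> (\<forall>\<^sub>F y in nhds 0. P 0 y = 0)"
    and no_zeros: "\<exists>U. open U \<and> (0,0) \<in> U \<and>
        (\<forall>(x::real) y. (complex_of_real x, y) \<in> U \<and> Im y > 0 \<longrightarrow> P (complex_of_real x) y \<noteq> 0)"
    and coprime: "no_common_factor P (conj2 P)"
    and M_def: "int M = zorder (\<lambda>y. P 0 y) 0"
    and u_unit: "conv2 u" "u 0 0 \<noteq> 0"
    and k_pos: "k \<ge> 1"
    and q0: "\<And>j. j < M \<Longrightarrow> poly (q j) 0 = 0"
    and q_deg: "\<And>j. j < M \<Longrightarrow> q j = 0 \<or> degree (q j) < 2 * L j"
    and \<psi>_conv: "\<And>j. j < M \<Longrightarrow> conv1 (\<psi> j)"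
    and \<psi>_im: "\<And>j. j < M \<Longrightarrow> Im (\<psi> j 0) > 0"
    and factor: "\<forall>\<^sub>F z in nhds (0,0). P (fst z ^ k) (snd z) =
        u (fst z ^ k) (snd z) * (\<Prod>j<M. snd z + poly (map_poly complex_of_real (q j)) (fst z ^ k)
                                        + (fst z ^ k) ^ (2 * L j) * \<psi> j (fst z))"
    and Q_conv: "conv2 Q"
    and QP_bdd: "Linf_loc (\<lambda>z. restrR2 Q z / restrR2 P z)"
  shows "\<forall>p::real. 1 \<le> p \<and> real (Max (insert 0 ((\<lambda>j. 2 * L j) ` {..<M}))) * p
                          < real (Max (insert 0 ((\<lambda>j. 2 * L j) ` {..<M}))) + 1
           \<longrightarrow> Lp_loc p (dy (\<lambda>z. restrR2 Q z / restrR2 P z))"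
proof (intro allI impI, elim conjE)
  define K where "K = Max (insert 0 ((\<lambda>j. 2 * L j) ` {..<M}))"
  fix p :: real
  assume p: "1 \<le> p" and "real (Max (insert 0 ((\<lambda>j. 2 * L j) ` {..<M}))) * p
      < real (Max (insert 0 ((\<lambda>j. 2 * L j) ` {..<M}))) + 1"
  then have pK: "real K * p < real K + 1" by (simp only: K_def)
  let ?f = "\<lambda>z. restrR2 Q z / restrR2 P z"
  obtain \<tau> where \<tau>: "\<And>x. \<tau> x ^ k = complex_of_real x" "isCont \<tau> 0" "\<tau> 0 = 0"
    using real_root_branch[OF k_pos] by blast
  obtain e where e: "e > 0" and factor_e: "\<And>t y. norm t < e \<Longrightarrow> norm y < e \<Longrightarrow> P (t ^ k) y =
        u (t ^ k) y * (\<Prod>j<M. y + poly (map_poly complex_of_real (q j)) (t ^ k) + (t ^ k) ^ (2 * L j) * \<psi> j t)"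
    using eventually_nhds_box[OF factor] by blast

  have poly_q0: "poly (map_poly complex_of_real (q j)) 0 = 0" if "j < M" for j
    using poly_map_poly_of_real[of "q j" 0] q0[OF that] by simp
  have L_pos: "L j > 0" if "j < M" for j
  proof -
    obtain r where "r > 0" "u 0 holomorphic_on ball 0 r"
      using conv2_regular[OF u_unit(1)] by (metis norm_zero)
    moreover have "\<forall>\<^sub>F y in nhds 0. P 0 y = u 0 y * (\<Prod>j<M. y + 0 ^ (2 * L j) * \<psi> j 0)"
      unfolding eventually_nhds_metric
    proof (intro exI[of _ e] conjI allI impI)
      fix y :: complex assume "dist y 0 < e"
      then show "P 0 y = u 0 y * (\<Prod>j<M. y + 0 ^ (2 * L j) * \<psi> j 0)"
        using factor_e[of 0 y] e k_pos poly_q0 by (simp add: zero_power)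
    qed (rule e)
    ultimately show ?thesis
      using exponents_positive[of "u 0" r M "\<lambda>j. \<psi> j 0" "P 0" L j] u_unit(2) \<psi>_im M_def that by force
  qed

  define a where "a j x = - of_real (poly (q j) x) - of_real (x ^ (2 * L j)) * \<psi> j (\<tau> x)" for j and x :: real
  have a_lim: "(a j \<longlongrightarrow> 0) (nhds 0)" if "j < M" for j
    unfolding a_def
    using root_estimates(1)[OF conv1_isCont[OF \<psi>_conv[OF that]] \<psi>_im[OF that] \<tau>(2,3) L_pos[OF that] q0[OF that]] .
  have "\<forall>j. \<exists>c. j < M \<longrightarrow> c > 0 \<and> (\<forall>\<^sub>F x in nhds 0. (x \<noteq> 0 \<longrightarrow> Im (a j x) < 0) \<and>
      (\<forall>y. c * \<bar>y + poly (q j) x\<bar> \<le> norm (of_real y - a j x) \<and> c * \<bar>x\<bar> ^ (2 * L j) \<le> norm (of_real y - a j x)))"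
    unfolding a_def
    using root_estimates(2)[OF conv1_isCont[OF \<psi>_conv] \<psi>_im \<tau>(2,3) L_pos q0] by blast
  from choice[OF this] obtain c where c: "\<And>j. j < M \<Longrightarrow> c j > 0"
    and a_ev: "\<And>j. j < M \<Longrightarrow> \<forall>\<^sub>F x in nhds 0. (x \<noteq> 0 \<longrightarrow> Im (a j x) < 0) \<and>
      (\<forall>y. c j * \<bar>y + poly (q j) x\<bar> \<le> norm (of_real y - a j x) \<and> c j * \<bar>x\<bar> ^ (2 * L j) \<le> norm (of_real y - a j x))"
    by auto

  obtain U C1 where U: "open U" "(0,0) \<in> U" and AE_bd: "AE z in lebesgue_on U. norm (?f z) \<le> C1"
    using QP_bdd unfolding Linf_loc_def by blast
  have "\<forall>\<^sub>F z in nhds (0,0). (fst z, snd z) \<in> U"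
    using eventually_nhds_in_open[OF U] by simp
  then obtain eU where eU: "eU > 0" "\<And>x y. norm x < eU \<Longrightarrow> norm y < eU \<Longrightarrow> (x, y) \<in> U"
    using eventually_nhds_box[of "\<lambda>x y. (x, y) \<in> U"] by blast

  define \<epsilon> where "\<epsilon> = norm (u 0 0) / 2"
  have \<epsilon>: "\<epsilon> > 0" using u_unit(2) by (simp add: \<epsilon>_def)
  have "\<forall>\<^sub>F R in at_right (0::real). 0 < R \<and> R < min e eU"
    using e eU(1) unfolding eventually_at_right_field by (intro exI[of _ "min e eU"]) auto
  moreover note eventually_tame_polydisc[OF P_conv \<epsilon>] eventually_tame_polydisc[OF u_unit(1) \<epsilon>]
    eventually_tame_polydisc[OF Q_conv \<epsilon>]
  ultimately have "\<forall>\<^sub>F R in at_right 0. (0 < R \<and> R < min e eU) \<and>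
      tame_polydisc P \<epsilon> R \<and> tame_polydisc u \<epsilon> R \<and> tame_polydisc Q \<epsilon> R"
    by eventually_elim simp
  from eventually_happens'[OF _ this] obtain R where R: "0 < R" "R < e" "R < eU"
    and tame: "tame_polydisc P \<epsilon> R" "tame_polydisc u \<epsilon> R" "tame_polydisc Q \<epsilon> R"
    by auto
  note P_cont = tame(1)[unfolded tame_polydisc_def, THEN conjunct1]
    and P_hol = tame(1)[unfolded tame_polydisc_def, THEN conjunct2, THEN conjunct1, rule_format]
    and u_hol = tame(2)[unfolded tame_polydisc_def, THEN conjunct2, THEN conjunct1, rule_format]
    and u_near = tame(2)[unfolded tame_polydisc_def, THEN conjunct2, THEN conjunct2, rule_format]
    and Q_cont = tame(3)[unfolded tame_polydisc_def, THEN conjunct1]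
    and Q_hol = tame(3)[unfolded tame_polydisc_def, THEN conjunct2, THEN conjunct1, rule_format]
    and Q_near = tame(3)[unfolded tame_polydisc_def, THEN conjunct2, THEN conjunct2, rule_format]
  have u_low: "norm (u x y) \<ge> \<epsilon>" and u_up: "norm (u x y) \<le> 3 * \<epsilon>"
    if "norm x < R" "norm y < R" for x y
    using u_near[OF that] norm_triangle_ineq3[of "u x y" "u 0 0"] by (auto simp: \<epsilon>_def)
  define D where "D = norm (Q 0 0) + \<epsilon>"
  have Q_up: "norm (Q x y) \<le> D" if "norm x < R" "norm y < R" for x y
    using Q_near[OF that] norm_triangle_ineq2[of "Q x y" "Q 0 0"] by (simp add: D_def)
  have D: "D \<ge> 0" using \<epsilon> by (simp add: D_def)

  define r where "r = R / 2"
  have r: "0 < r" "r < R" using R by (simp_all add: r_def)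
  have "\<forall>\<^sub>F x in nhds 0. norm (\<tau> x) < e \<and> (\<forall>j\<in>{..<M}. norm (a j x) < r / 2 \<and> (x \<noteq> 0 \<longrightarrow> Im (a j x) < 0) \<and>
      (\<forall>y. c j * \<bar>y + poly (q j) x\<bar> \<le> norm (of_real y - a j x) \<and> c j * \<bar>x\<bar> ^ (2 * L j) \<le> norm (of_real y - a j x)))"
  proof (intro eventually_conj eventually_ball_finite ballI)
    have "(\<tau> \<longlongrightarrow> 0) (nhds 0)" using \<tau>(2,3) by (simp add: isCont_def tendsto_nhds_iff)
    from order_tendstoD(2)[OF tendsto_norm_zero[OF this] e] show "\<forall>\<^sub>F x in nhds 0. norm (\<tau> x) < e" .
    fix j assume "j \<in> {..<M}"
    then have j: "j < M" by simp
    show "\<forall>\<^sub>F x in nhds 0. norm (a j x) < r / 2"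
      by (rule order_tendstoD(2)[OF tendsto_norm_zero[OF a_lim[OF j]]]) (use r in simp)
    show "\<forall>\<^sub>F x in nhds 0. x \<noteq> 0 \<longrightarrow> Im (a j x) < 0"
      using a_ev[OF j] by (rule eventually_mono) blast
    show "\<forall>\<^sub>F x in nhds 0. \<forall>y. c j * \<bar>y + poly (q j) x\<bar> \<le> norm (of_real y - a j x) \<and> c j * \<bar>x\<bar> ^ (2 * L j) \<le> norm (of_real y - a j x)"
      using a_ev[OF j] by (rule eventually_mono) blast
  qed simp
  then obtain s0 where s0: "s0 > 0" and small_\<tau>: "\<And>x. \<bar>x\<bar> < s0 \<Longrightarrow> norm (\<tau> x) < e"
    and norm_a: "\<And>x j. \<bar>x\<bar> < s0 \<Longrightarrow> j < M \<Longrightarrow> norm (a j x) \<le> r / 2"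
    and Im_a: "\<And>x j. \<bar>x\<bar> < s0 \<Longrightarrow> j < M \<Longrightarrow> x \<noteq> 0 \<Longrightarrow> Im (a j x) < 0"
    and root_q: "\<And>x j y. \<bar>x\<bar> < s0 \<Longrightarrow> j < M \<Longrightarrow> c j * \<bar>y + poly (q j) x\<bar> \<le> norm (of_real y - a j x)"
    and root_x: "\<And>x j y. \<bar>x\<bar> < s0 \<Longrightarrow> j < M \<Longrightarrow> c j * \<bar>x\<bar> ^ (2 * L j) \<le> norm (of_real y - a j x)"
    unfolding eventually_nhds_metric dist_real_def by (auto simp: less_imp_le)
  define s where "s = min s0 (min 1 (r / 2))"
  have s: "0 < s" "s \<le> s0" "s \<le> 1" "s \<le> r / 2" "s < R" using s0 r by (auto simp: s_def)
  have P_eq: "P (of_real x) y = u (of_real x) y * (\<Prod>j<M. y - a j x)" if "\<bar>x\<bar> < s" "norm y < R" for x y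
  proof -
    have "norm (\<tau> x) < e" using that s by (intro small_\<tau>) auto
    with factor_e[of "\<tau> x" y] that R show ?thesis
      by (simp add: \<tau>(1) poly_map_poly_of_real a_def algebra_simps)
  qed
  have a_nz: "of_real y \<noteq> a j x" if "\<bar>x\<bar> < s" "j < M" "(x, y) \<noteq> (0, 0)" for x y j
  proof (cases "x = 0")
    case True
    with q0[OF that(2)] L_pos[OF that(2)] have "a j x = 0" by (simp add: a_def)
    with that True show ?thesis by simp
  next
    case False
    with Im_a[of x j] that s have "Im (a j x) \<noteq> Im (of_real y)" by simp
    then show ?thesis by metis
  qed
  have P_nz: "P (of_real x) (of_real y) \<noteq> 0" if "\<bar>x\<bar> < s" "\<bar>y\<bar> < R" "(x, y) \<noteq> (0, 0)" for x y
    using that a_nz[of x _ y] u_low[of "of_real x" "of_real y"] \<epsilon> s by (subst P_eq) auto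

  define \<Omega> where "\<Omega> = {-s<..<s} \<times> {-R<..<R} - {(0::real, 0::real)}"
  have \<Omega>: "open \<Omega>" unfolding \<Omega>_def by (intro open_Diff open_Times) auto
  have \<Omega>_iff: "(x, y) \<in> \<Omega> \<longleftrightarrow> \<bar>x\<bar> < s \<and> \<bar>y\<bar> < R \<and> (x, y) \<noteq> (0, 0)" for x y
    by (auto simp: \<Omega>_def)
  have f_cont: "continuous_on \<Omega> ?f"
  proof (intro continuous_intros)
    have sub: "(\<lambda>z. (complex_of_real (fst z), complex_of_real (snd z))) ` \<Omega> \<subseteq> ball 0 R \<times> ball 0 R"
      using s by (auto simp: \<Omega>_iff)
    have cont: "continuous_on \<Omega> (\<lambda>z. (complex_of_real (fst z), complex_of_real (snd z)))"
      by (intro continuous_intros)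
    show "continuous_on \<Omega> (restrR2 Q)" "continuous_on \<Omega> (restrR2 P)"
      using continuous_on_compose2[OF Q_cont cont sub] continuous_on_compose2[OF P_cont cont sub]
      by (simp_all add: restrR2_def[abs_def])
    show "\<forall>z\<in>\<Omega>. restrR2 P z \<noteq> 0"
    proof
      fix z assume "z \<in> \<Omega>"
      then show "restrR2 P z \<noteq> 0"
        using P_nz[of "fst z" "snd z"] by (cases z) (auto simp: \<Omega>_iff restrR2_def)
    qed
  qed
  have f_deriv: "((\<lambda>t. ?f (x, t)) has_vector_derivative
      deriv (\<lambda>y. Q (of_real x) y / P (of_real x) y) (of_real y)) (at y)" if "(x, y) \<in> \<Omega>" for x y
  proof -
    note xy = that[unfolded \<Omega>_iff]
    let ?V = "ball 0 R \<inter> P (of_real x) -` (- {0})"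
    have hol: "P (of_real x) holomorphic_on ball 0 R" "Q (of_real x) holomorphic_on ball 0 R"
      using xy s P_hol Q_hol by simp_all
    have "open ?V"
      using hol by (intro continuous_open_preimage holomorphic_on_imp_continuous_on) auto
    moreover have "(\<lambda>y. Q (of_real x) y / P (of_real x) y) holomorphic_on ?V"
      by (intro holomorphic_intros holomorphic_on_subset[OF hol(1)] holomorphic_on_subset[OF hol(2)]) auto
    moreover have "of_real y \<in> ?V" using xy P_nz[of x y] by simp
    ultimately show ?thesis
      using has_vector_derivative_real_restriction by (fastforce simp: restrR2_def)
  qed
  have dy_f: "dy ?f (x, y) = deriv (\<lambda>y. Q (of_real x) y / P (of_real x) y) (of_real y)"
    if "(x, y) \<in> \<Omega>" for x y
    using vector_derivative_at[OF f_deriv[OF that]] by (simp add: dy_def)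

  have f_bd: "norm (?f z) \<le> C1" if "z \<in> \<Omega>" for z
    using AE_bound_imp_bound_on_open[OF U(1) \<Omega> _ f_cont AE_bd that] eU(2) R s
    by (force simp: \<Omega>_iff)
  define C where "C = max (\<bar>C1\<bar> * (3 * \<epsilon>)) (D / (r / 2) ^ M)"
  have C: "C \<ge> 0" using \<epsilon> by (simp add: C_def le_max_iff_disj)
  have "D / (r / 2) ^ M \<le> C" by (simp add: C_def)
  then have DC: "D \<le> C * (r / 2) ^ M" using r by (simp add: pos_divide_le_eq)
  have Q_real: "norm (Q (of_real x) (of_real y)) \<le> C * norm (\<Prod>j<M. of_real y - a j x)"
    if x: "\<bar>x\<bar> < s" "x \<noteq> 0" and y: "\<bar>y\<bar> \<le> r" for x y
  proof -
    have xy: "(x, y) \<in> \<Omega>" using x y r by (auto simp: \<Omega>_iff)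
    have "norm (Q (of_real x) (of_real y)) \<le> C1 * norm (P (of_real x) (of_real y))"
      using f_bd[OF xy] P_nz[of x y] x y r by (simp add: restrR2_def norm_divide divide_le_eq)
    also have "\<dots> = C1 * (norm (u (of_real x) (of_real y)) * norm (\<Prod>j<M. of_real y - a j x))"
      using x y r by (subst P_eq) (auto simp: norm_mult)
    also have "\<dots> \<le> \<bar>C1\<bar> * (3 * \<epsilon> * norm (\<Prod>j<M. of_real y - a j x))"
      using u_up[of "of_real x" "of_real y"] x y s r by (intro mult_mono mult_right_mono) auto
    also have "\<dots> = (\<bar>C1\<bar> * (3 * \<epsilon>)) * norm (\<Prod>j<M. of_real y - a j x)" by simp
    also have "\<dots> \<le> C * norm (\<Prod>j<M. of_real y - a j x)"
      by (intro mult_right_mono) (auto simp: C_def)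
    finally show ?thesis .
  qed

  define C' where "C' = C * 3 ^ M / \<epsilon>"
  have C': "C' \<ge> 0" using C \<epsilon> by (simp add: C'_def)
  have dy_bd: "norm (dy ?f (x, y)) \<le> C' / d"
    if x: "\<bar>x\<bar> < s" "x \<noteq> 0" and y: "\<bar>y\<bar> < s"
      and d: "0 < d" "d \<le> r / 2" "\<And>j. j < M \<Longrightarrow> d \<le> norm (of_real y - a j x) / 2" for x y d
  proof -
    have xR: "norm (complex_of_real x) < R" using x s by simp
    have "norm (deriv (\<lambda>w. Q (of_real x) w / (u (of_real x) w * (\<Prod>j<M. w - a j x))) (of_real y)) \<le> C' / d"
      unfolding C'_def
    proof (rule deriv_bound_near_real_point[OF Q_hol[OF xR] u_hol[OF xR] r _ _ Q_real[OF x] _ DC C \<epsilon> _ _ d])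
      show "Im (a j x) < 0" "norm (a j x) \<le> r / 2" if "j < M" for j
        using Im_a[of x j] norm_a[of x j] that x s by auto
      show "norm (Q (of_real x) w) \<le> D" if "norm w = r" for w
        using Q_up[OF xR] that r by simp
      show "\<epsilon> \<le> norm (u (of_real x) w)" if "norm w \<le> r" for w
        using u_low[OF xR] that r by simp
      show "\<bar>y\<bar> \<le> r / 2" using y s by simp
    qed
    moreover have "\<forall>\<^sub>F w in nhds (of_real y). Q (of_real x) w / P (of_real x) w
        = Q (of_real x) w / (u (of_real x) w * (\<Prod>j<M. w - a j x))"
      using eventually_nhds_in_open[of "ball 0 R" "complex_of_real y"] y s
      by (auto elim!: eventually_mono simp: P_eq[OF x(1)])
    ultimately show ?thesis
      using dy_f[of x y] x y s deriv_cong_ev by (fastforce simp: \<Omega>_iff)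
  qed

  define B where "B = 2 * C' / r + (\<Sum>j<M. 2 * C' / c j)"
  have sum_nonneg: "(\<Sum>j<M. 2 * C' / c j) \<ge> 0" using C' c by (intro sum_nonneg) (auto simp: less_imp_le)
  have alternatives: "norm (dy ?f (x, y)) \<le> B \<or> (\<exists>j<M. norm (dy ?f (x, y)) * \<bar>y + poly (q j) x\<bar> \<le> B \<and>
      norm (dy ?f (x, y)) * \<bar>x\<bar> ^ (2 * L j) \<le> B)" if x: "\<bar>x\<bar> < s" and y: "\<bar>y\<bar> < s" and x0: "x \<noteq> 0" for x y
  proof -
    let ?N = "norm (dy ?f (x, y))"
    obtain d where d: "d > 0" "d \<le> r / 2" "\<And>j. j < M \<Longrightarrow> d \<le> norm (of_real y - a j x) / 2"
      "d = r / 2 \<or> (\<exists>j<M. d = norm (of_real y - a j x) / 2)"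
      using ex_distance_to_roots[of "r / 2" M "of_real y" "\<lambda>j. a j x"] a_nz[OF x] r x0 by auto
    have N: "?N \<le> C' / d" by (rule dy_bd[OF x x0 y d(1-3)])
    from d(4) show ?thesis
    proof (elim disjE exE conjE)
      assume "d = r / 2"
      with N sum_nonneg show ?thesis by (simp add: B_def mult.commute)
    next
      fix j assume j: "j < M" and dj: "d = norm (of_real y - a j x) / 2"
      have "?N * norm (of_real y - a j x) \<le> 2 * C'"
        using N d(1) by (simp add: dj field_simps)
      moreover have "?N * (c j * \<bar>y + poly (q j) x\<bar>) \<le> ?N * norm (of_real y - a j x)"
        "?N * (c j * \<bar>x\<bar> ^ (2 * L j)) \<le> ?N * norm (of_real y - a j x)"
        using root_q[of x j y] root_x[of x j y] x s j by (auto intro!: mult_left_mono)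
      ultimately have "?N * \<bar>y + poly (q j) x\<bar> \<le> 2 * C' / c j" "?N * \<bar>x\<bar> ^ (2 * L j) \<le> 2 * C' / c j"
        using c[OF j] by (simp_all add: field_simps)
      moreover have "2 * C' / c j \<le> (\<Sum>j<M. 2 * C' / c j)"
        using j C' c by (intro member_le_sum) (auto simp: less_imp_le)
      moreover have "2 * C' / r \<ge> 0" using C' r by simp
      ultimately show ?thesis using j by (intro disjI2 exI[of _ j]) (auto simp: B_def)
    qed
  qed

  let ?S = "{-s<..<s} \<times> {-s<..<s} :: (real \<times> real) set"
  have S_sub: "?S - {(0, 0)} \<subseteq> \<Omega>" using s by (auto simp: \<Omega>_iff)
  have S_open: "open ?S" by (intro open_Times) auto
  have meas: "dy ?f \<in> borel_measurable (lebesgue_on ?S)"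
  proof (rule dy_measurable[OF S_open continuous_on_subset[OF f_cont S_sub]])
    fix z assume "z \<in> ?S - {(0, 0)}"
    then have "(fst z, snd z) \<in> \<Omega>" using S_sub by auto
    from f_deriv[OF this] show "(\<lambda>t. ?f (fst z, t)) differentiable at (snd z)"
      by (rule differentiableI_vector)
  qed
  have "0 < 2 * L j \<and> 2 * L j \<le> K" if "j < M" for j
    using L_pos[OF that] that by (auto simp: K_def intro!: Max_ge)
  from integrable_powr_of_root_bounds[OF s(1,3) meas alternatives this p pK]
  have "integrable (lebesgue_on ?S) (\<lambda>z. norm (dy ?f z) powr p)" .
  with meas S_open s(1) show "Lp_loc p (dy ?f)"
    unfolding Lp_loc_def by (intro exI[of _ ?S]) auto
qed

end
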